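(* For any $f,g\in L_1(\mathbb{R})$, $$\big\|f \underset{H_1,F}{*} g\big\|_{L_1(\mathbb{R})} \leq \sqrt{\frac{2}{\pi}}\, \|f\|_{L_1(\mathbb{R})} \|g\|_{L_1(\mathbb{R})}.$$
   Context: The Hartley-Fourier generalized convolution of $f$ and $g$ is $$\big(f\underset{H_1,F}{*}g\big)(x):=\frac{1}{2\sqrt{2\pi}}\int_{\mathbb{R}} g(y)\,[f(x+y)+f(x-y)+i\,f(-x-y)-i\,f(-x+y)]\,dy,\quad x\in\mathbb{R}.$$ $\|f\|_{L_1(\mathbb{R})}=\int_{\mathbb{R}}|f(x)|\,dx$. *)

theory Defs
  imports "HOL-Analysis.Analysis"
begin

text \<open>
  Elements of \<open>L\<^sub>1(\<real>)\<close> are represented by complex-valued functions that are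
  integrable with respect to \<^const>\<open>lebesgue\<close>, the completed measure, so representatives need
  not be Borel measurable.
\<close>

definition hartley_fourier_integrand ::
    "(real \<Rightarrow> complex) \<Rightarrow> (real \<Rightarrow> complex) \<Rightarrow> real \<Rightarrow> real \<Rightarrow> complex" where
  "hartley_fourier_integrand f g x y =
     g y * (f (x + y) + f (x - y) + \<i> * f (- x - y) - \<i> * f (- x + y))"

text \<open>
  The Bochner integral is \<open>0\<close> when the integrand is not integrable, so the value below is
  meaningful only at those \<open>x\<close> where the integrand is integrable in \<open>y\<close>.
\<close>

definition hartley_fourier_conv ::
    "(real \<Rightarrow> complex) \<Rightarrow> (real \<Rightarrow> complex) \<Rightarrow> real \<Rightarrow> complex" where
  "hartley_fourier_conv f g x =
     complex_of_real (1 / (2 * sqrt (2 * pi))) *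
       (\<integral>y. hartley_fourier_integrand f g x y \<partial>lebesgue)"

definition L1_norm :: "(real \<Rightarrow> complex) \<Rightarrow> real" where
  "L1_norm f = (\<integral>x. cmod (f x) \<partial>lebesgue)"

end

theory Submission
  imports Defs
begin

text \<open>
  The bound is Young's inequality for \<open>p = q = 1\<close>, applied four times. Each of the four summands of
  the kernel has the shape \<open>g y * f (c * x + d * y)\<close> with \<open>c, d = \<plusminus>1\<close>, and for fixed \<open>y\<close> the
  substitution \<open>x \<mapsto> c * x + d * y\<close> preserves Lebesgue measure. Integrating first over \<open>x\<close>, Tonelli
  shows that each summand is integrable over the plane with norm at most \<open>\<parallel>f\<parallel> * \<parallel>g\<parallel>\<close>. Four summands and
  the prefactor \<open>1 / (2 * sqrt (2 * \<pi>))\<close> give the constant \<open>2 / sqrt (2 * \<pi>) = sqrt (2 / \<pi>)\<close>; Fubini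
  also yields integrability of the kernel in \<open>y\<close> for almost all \<open>x\<close>, and of the convolution in \<open>x\<close>.

  Fubini is applied on the product of two Borel measure spaces, whereas \<open>f\<close> and \<open>g\<close> are only Lebesgue
  measurable, so \<open>(x, y) \<mapsto> f (x + y)\<close> need not be measurable for the product \<open>\<sigma>\<close>-algebra. This is
  circumvented by passing to Borel representatives of \<open>f\<close> and \<open>g\<close>. Invertible affine maps of the line preserve
  null sets, so for every single \<open>x\<close> the kernels of the two pairs agree for almost all \<open>y\<close>; hence the
  convolutions of the two pairs agree at every point, and not just almost everywhere.
\<close>

section \<open>Borel representatives\<close>

lemma AE_lborel_affine:
  fixes c t :: real
  assumes "c \<noteq> 0" and "AE x in lborel. P x"
  shows "AE x in lborel. P (t + c * x)"
proof -
  from assms(2) obtain N where N: "N \<in> sets lborel" "emeasure lborel N = 0" "{x. \<not> P x} \<subseteq> N"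
    by (auto elim!: AE_E)
  have "AE x in lborel. x \<notin> N"
    using N by (intro AE_not_in null_setsI) auto
  then have "AE x in lborel. t + c * x \<notin> N"
    using N(1) \<open>c \<noteq> 0\<close> by (intro AE_borel_affine[where P = "\<lambda>x. x \<notin> N"]) auto
  then show ?thesis
    using N(3) by (auto elim!: eventually_mono)
qed

lemma integrable_lebesgue_obtains_borel:
  fixes f :: "real \<Rightarrow> complex"
  assumes f: "integrable lebesgue f"
  obtains f' where "integrable lborel f'" "AE x in lborel. f x = f' x"
proof -
  have "(\<lambda>x. Re (f x)) \<in> borel_measurable lebesgue" "(\<lambda>x. Im (f x)) \<in> borel_measurable lebesgue"
    using f by auto
  from this[THEN completion_ex_borel_measurable_real] obtain u v
    where [measurable]: "u \<in> borel_measurable lborel" "v \<in> borel_measurable lborel"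
      and uv: "AE x in lborel. Re (f x) = u x" "AE x in lborel. Im (f x) = v x"
    by blast
  define f' where "f' x = complex_of_real (u x) + \<i> * complex_of_real (v x)" for x
  have meas [measurable]: "f' \<in> borel_measurable lborel"
    unfolding f'_def by measurable
  have eq: "AE x in lborel. f x = f' x"
    using uv by eventually_elim (simp add: f'_def complex_eq_iff)
  have "integrable lebesgue f'"
  proof (rule integrable_cong_AE_imp[OF f])
    show "f' \<in> borel_measurable lebesgue"
      using meas by (rule measurable_completion)
    show "AE x in lebesgue. f x = f' x"
      using eq by (rule AE_completion)
  qed
  then have "integrable lborel f'"
    by (simp add: integrable_completion)
  then show thesis
    using eq by (rule that)
qed

section \<open>The kernel on the plane\<close>

text \<open>For fixed \<open>y\<close> the integral over \<open>x\<close> of the norm is \<open>cmod (g y)\<close> times a constant, since the integral of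
  \<open>cmod \<circ> f\<close> merely rescales under the substitution \<open>x \<mapsto> d * y + c * x\<close>; this is integrable in \<open>y\<close>, so
  Tonelli applies in the order \<open>dx dy\<close>.\<close>

lemma integrable_mult_affine_pair:
  fixes f g :: "real \<Rightarrow> complex" and c d :: real
  assumes f: "integrable lborel f" and g: "integrable lborel g" and c: "c \<noteq> 0"
  shows "integrable (lborel \<Otimes>\<^sub>M lborel) (\<lambda>(y, x). g y * f (d * y + c * x))"
proof (rule lborel_pair.Fubini_integrable)
  have [measurable]: "f \<in> borel_measurable borel" "g \<in> borel_measurable borel"
    using f g by auto
  show "(\<lambda>(y, x). g y * f (d * y + c * x)) \<in> borel_measurable (lborel \<Otimes>\<^sub>M lborel)"
    by measurable
  have "(\<integral>x. cmod (f (t + c * x)) \<partial>lborel) = (\<integral>x. cmod (f x) \<partial>lborel) / \<bar>c\<bar>" for t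
    using c lborel_integral_real_affine[OF c, of "\<lambda>x. cmod (f x)" t] by simp
  then show "integrable lborel (\<lambda>y. \<integral>x. norm (case (y, x) of (y, x) \<Rightarrow> g y * f (d * y + c * x)) \<partial>lborel)"
    using g by (simp add: norm_mult)
  show "AE y in lborel. integrable lborel (\<lambda>x. case (y, x) of (y, x) \<Rightarrow> g y * f (d * y + c * x))"
    using lborel_integrable_real_affine[OF f c] by simp
qed

text \<open>The standard bound for an integral operator with a kernel integrable on the plane: move the norm
  under the inner integral and exchange the order of integration.\<close>

lemma integral_norm_integral_le:
  fixes k :: "real \<times> real \<Rightarrow> complex"
  assumes k: "integrable (lborel \<Otimes>\<^sub>M lborel) k"
  shows "(\<integral>x. cmod (\<integral>y. k (y, x) \<partial>lborel) \<partial>lborel) \<le> (\<integral>y. (\<integral>x. cmod (k (y, x)) \<partial>lborel) \<partial>lborel)"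
proof -
  have kn: "integrable (lborel \<Otimes>\<^sub>M lborel) (\<lambda>(y, x). cmod (k (y, x)))"
    using k by (simp add: case_prod_unfold)
  have k2: "integrable (lborel \<Otimes>\<^sub>M lborel) (\<lambda>(y, x). k (y, x))"
    using k by (simp add: case_prod_unfold)
  have "(\<integral>x. cmod (\<integral>y. k (y, x) \<partial>lborel) \<partial>lborel) \<le> (\<integral>x. (\<integral>y. cmod (k (y, x)) \<partial>lborel) \<partial>lborel)"
    using lborel_pair.integrable_snd[OF k2] lborel_pair.integrable_snd[OF kn]
    by (intro integral_mono integral_norm_bound) auto
  also have "\<dots> = (\<integral>y. (\<integral>x. cmod (k (y, x)) \<partial>lborel) \<partial>lborel)"
    using lborel_pair.Fubini_integral[OF kn] .
  finally show ?thesis .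
qed

lemma integrable_hartley_fourier_integrand_pair:
  assumes f: "integrable lborel f" and g: "integrable lborel g"
  shows "integrable (lborel \<Otimes>\<^sub>M lborel) (\<lambda>(y, x). hartley_fourier_integrand f g x y)"
proof -
  define K where "K d c p = (case p of (y, x) \<Rightarrow> g y * f (d * y + c * x))" for d c :: real and p
  have K: "integrable (lborel \<Otimes>\<^sub>M lborel) (K d c)" if "c \<noteq> 0" for c d
    using integrable_mult_affine_pair[OF f g that, of d] by (simp add: K_def[abs_def])
  have expand: "z * (a + b + \<i> * p - \<i> * q) = z * a + z * b + \<i> * (z * p) - \<i> * (z * q)"
    for z a b p q :: complex
    by (simp add: algebra_simps)
  \<comment> \<open>the unit coefficients are kept explicit so that each summand is literally an instance of \<open>K\<close>\<close>
  have split: "hartley_fourier_integrand f g x y =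
    g y * f (1 * y + 1 * x) + g y * f ((-1) * y + 1 * x)
      + \<i> * (g y * f ((-1) * y + (-1) * x)) - \<i> * (g y * f (1 * y + (-1) * x))" for x y
  proof -
    have args: "x + y = 1 * y + 1 * x" "x - y = (-1) * y + 1 * x"
      "- x - y = (-1) * y + (-1) * x" "- x + y = 1 * y + (-1) * x"
      by simp_all
    show ?thesis
      unfolding hartley_fourier_integrand_def expand args by (rule refl)
  qed
  have sum: "(\<lambda>(y, x). hartley_fourier_integrand f g x y) =
    (\<lambda>p. K 1 1 p + K (-1) 1 p + \<i> * K (-1) (-1) p - \<i> * K 1 (-1) p)"
    unfolding split K_def case_prod_unfold by (rule refl)
  show ?thesis
    unfolding sum
    by (intro Bochner_Integration.integrable_add Bochner_Integration.integrable_diff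
        integrable_mult_right K) simp_all
qed

lemma integral_cmod_hartley_fourier_integrand_le:
  assumes f: "integrable lborel f"
  shows "(\<integral>x. cmod (hartley_fourier_integrand f g x y) \<partial>lborel) \<le> 4 * (\<integral>x. cmod (f x) \<partial>lborel) * cmod (g y)"
proof -
  have aff: "integrable lborel (\<lambda>x. f (t + c * x))"
    "(\<integral>x. cmod (f (t + c * x)) \<partial>lborel) = (\<integral>x. cmod (f x) \<partial>lborel)" if "\<bar>c\<bar> = 1" for t c
  proof -
    have "c \<noteq> 0" using that by auto
    then show "integrable lborel (\<lambda>x. f (t + c * x))"
      by (rule lborel_integrable_real_affine[OF f])
    show "(\<integral>x. cmod (f (t + c * x)) \<partial>lborel) = (\<integral>x. cmod (f x) \<partial>lborel)"
      using lborel_integral_real_affine[OF \<open>c \<noteq> 0\<close>, of "\<lambda>x. cmod (f x)" t] that by simp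
  qed
  define S where "S t c x = cmod (f (t + c * x))" for t c x
  have S: "integrable lborel (S t c)" "integral\<^sup>L lborel (S t c) = (\<integral>x. cmod (f x) \<partial>lborel)"
    if "\<bar>c\<bar> = 1" for t c
    unfolding S_def using aff[OF that] by auto
  let ?S = "\<lambda>x. S y 1 x + S (-y) 1 x + S (-y) (-1) x + S y (-1) x"
  have bound: "cmod (hartley_fourier_integrand f g x y) \<le> cmod (g y) * ?S x" for x
  proof -
    have tri: "cmod (a + b + \<i> * p - \<i> * q) \<le> cmod a + cmod b + cmod p + cmod q" for a b p q :: complex
    proof -
      have "cmod (a + b + \<i> * p - \<i> * q) \<le> cmod (a + b + \<i> * p) + cmod (\<i> * q)"
        by (rule norm_triangle_ineq4)
      also have "cmod (a + b + \<i> * p) \<le> cmod (a + b) + cmod (\<i> * p)"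
        by (rule norm_triangle_ineq)
      also have "cmod (a + b) \<le> cmod a + cmod b"
        by (rule norm_triangle_ineq)
      finally show ?thesis
        by (simp add: norm_mult)
    qed
    show ?thesis
      using tri[of "f (x + y)" "f (x - y)" "f (- x - y)" "f (- x + y)"]
      unfolding hartley_fourier_integrand_def norm_mult S_def
      by (intro mult_left_mono) (simp_all add: algebra_simps)
  qed
  have "(\<integral>x. cmod (hartley_fourier_integrand f g x y) \<partial>lborel) \<le> (\<integral>x. cmod (g y) * ?S x \<partial>lborel)"
    by (intro integral_mono' bound) (simp_all add: S, simp add: S_def)
  also have "\<dots> = 4 * (\<integral>x. cmod (f x) \<partial>lborel) * cmod (g y)"
    by (simp add: S)
  finally show ?thesis .
qed

lemma integral_cmod_integral_hartley_fourier_integrand_le: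
  assumes f: "integrable lborel f" and g: "integrable lborel g"
  shows "(\<integral>x. cmod (\<integral>y. hartley_fourier_integrand f g x y \<partial>lborel) \<partial>lborel)
    \<le> 4 * (\<integral>x. cmod (f x) \<partial>lborel) * (\<integral>y. cmod (g y) \<partial>lborel)"
proof -
  have "(\<integral>x. cmod (\<integral>y. hartley_fourier_integrand f g x y \<partial>lborel) \<partial>lborel)
      \<le> (\<integral>y. (\<integral>x. cmod (hartley_fourier_integrand f g x y) \<partial>lborel) \<partial>lborel)"
    using integral_norm_integral_le[OF integrable_hartley_fourier_integrand_pair[OF f g]] by simp
  also have "\<dots> \<le> (\<integral>y. 4 * (\<integral>x. cmod (f x) \<partial>lborel) * cmod (g y) \<partial>lborel)"
    using g by (intro integral_mono' integral_cmod_hartley_fourier_integrand_le f) auto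
  also have "\<dots> = 4 * (\<integral>x. cmod (f x) \<partial>lborel) * (\<integral>y. cmod (g y) \<partial>lborel)"
    by simp
  finally show ?thesis .
qed

section \<open>Transfer to Lebesgue integrable functions\<close>

text \<open>The exceptional null set depends on \<open>x\<close>, but no \<open>x\<close> is excluded.\<close>

lemma AE_hartley_fourier_integrand_cong:
  assumes "AE y in lborel. f y = f' y" and g: "AE y in lborel. g y = g' y"
  shows "AE y in lborel. hartley_fourier_integrand f g x y = hartley_fourier_integrand f' g' x y"
proof -
  have "AE y in lborel. f (t + c * y) = f' (t + c * y)" if "c \<noteq> 0" for t c
    using that assms(1) by (rule AE_lborel_affine)
  from this[of 1 x, simplified] this[of "-1" x, simplified]
    this[of "-1" "-x", simplified] this[of 1 "-x", simplified] g
  show ?thesis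
    by eventually_elim (simp add: hartley_fourier_integrand_def)
qed

text \<open>Almost everywhere equality to a Borel function suffices for the measurability required here, because Lebesgue
  measure is complete.\<close>

lemma lebesgue_integral_AE_eq_borel:
  fixes h h' :: "real \<Rightarrow> complex"
  assumes h': "h' \<in> borel_measurable lborel" and eq: "AE y in lborel. h y = h' y"
  shows "integrable lebesgue h \<longleftrightarrow> integrable lborel h'"
    and "integral\<^sup>L lebesgue h = integral\<^sup>L lborel h'"
proof -
  have ae: "AE y in lebesgue. h y = h' y"
    using eq by (rule AE_completion)
  have m': "h' \<in> borel_measurable lebesgue"
    using h' by (rule measurable_completion)
  have m: "h \<in> borel_measurable lebesgue"
    using m' ae by (intro borel_measurable_AE[OF m']) (auto simp: eq_commute)
  show "integrable lebesgue h \<longleftrightarrow> integrable lborel h'"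
    using integrable_cong_AE[OF m m' ae] h' by (simp add: integrable_completion)
  show "integral\<^sup>L lebesgue h = integral\<^sup>L lborel h'"
    using integral_cong_AE[OF m m' ae] h' by (simp add: integral_completion)
qed

theorem theorem3p2:
  fixes f g :: "real \<Rightarrow> complex"
  assumes "integrable lebesgue f"
    and "integrable lebesgue g"
  shows "(AE x in lebesgue. integrable lebesgue (hartley_fourier_integrand f g x)) \<and>
    integrable lebesgue (hartley_fourier_conv f g) \<and>
    L1_norm (hartley_fourier_conv f g) \<le> sqrt (2 / pi) * L1_norm f * L1_norm g"
proof -
  obtain f' where f': "integrable lborel f'" and ff': "AE x in lborel. f x = f' x"
    using integrable_lebesgue_obtains_borel[OF assms(1)] .
  obtain g' where g': "integrable lborel g'" and gg': "AE x in lborel. g x = g' x"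
    using integrable_lebesgue_obtains_borel[OF assms(2)] .
  have [measurable]: "f' \<in> borel_measurable borel" "g' \<in> borel_measurable borel"
    using f' g' by auto
  define h where "h x = (\<integral>y. hartley_fourier_integrand f' g' x y \<partial>lborel)" for x
  define C where "C = 1 / (2 * sqrt (2 * pi))"
  have "C \<ge> 0"
    by (simp add: C_def)
  have "hartley_fourier_integrand f' g' x \<in> borel_measurable lborel" for x
    unfolding hartley_fourier_integrand_def by measurable
  note transfer = lebesgue_integral_AE_eq_borel[OF this AE_hartley_fourier_integrand_cong[OF ff' gg']]
  note pair = integrable_hartley_fourier_integrand_pair[OF f' g']
  have conv: "hartley_fourier_conv f g = (\<lambda>x. complex_of_real C * h x)"
    by (rule ext) (simp add: hartley_fourier_conv_def transfer(2) h_def C_def)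

  have "integrable (lborel \<Otimes>\<^sub>M lborel) (\<lambda>(x, y). hartley_fourier_integrand f' g' x y)"
    using lborel_pair.integrable_product_swap[OF pair] by (simp add: case_prod_unfold)
  then have "AE x in lborel. integrable lborel (hartley_fourier_integrand f' g' x)"
    by (rule lborel_pair.AE_integrable_fst)
  then have ae: "AE x in lebesgue. integrable lebesgue (hartley_fourier_integrand f g x)"
    by (intro AE_completion) (simp add: transfer(1))

  have h: "integrable lborel h"
    unfolding h_def using lborel_pair.integrable_snd[OF pair] .
  then have int: "integrable lebesgue (hartley_fourier_conv f g)"
    by (simp add: conv integrable_completion)

  have norm_eq: "L1_norm u = (\<integral>x. cmod (u' x) \<partial>lborel)"
    if "integrable lebesgue u" "integrable lborel u'" "AE x in lborel. u x = u' x" for u u'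
  proof -
    have "L1_norm u = (\<integral>x. cmod (u' x) \<partial>lebesgue)"
      unfolding L1_norm_def
    proof (rule integral_cong_AE)
      show "(\<lambda>x. cmod (u x)) \<in> borel_measurable lebesgue"
        using that(1) by auto
      show "(\<lambda>x. cmod (u' x)) \<in> borel_measurable lebesgue"
        using that(2) by (auto intro: measurable_completion)
      show "AE x in lebesgue. cmod (u x) = cmod (u' x)"
        using AE_completion[OF that(3)] by eventually_elim simp
    qed
    also have "\<dots> = (\<integral>x. cmod (u' x) \<partial>lborel)"
      using that(2) by (intro integral_completion) auto
    finally show ?thesis .
  qed
  have "L1_norm (hartley_fourier_conv f g) = (\<integral>x. cmod (complex_of_real C * h x) \<partial>lborel)"
    using int h by (intro norm_eq) (auto simp: conv)
  also have "\<dots> = C * (\<integral>x. cmod (h x) \<partial>lborel)"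
    using \<open>C \<ge> 0\<close> by (simp add: norm_mult)
  also have "\<dots> \<le> C * (4 * (\<integral>x. cmod (f' x) \<partial>lborel) * (\<integral>x. cmod (g' x) \<partial>lborel))"
    unfolding h_def by (intro mult_left_mono integral_cmod_integral_hartley_fourier_integrand_le f' g' \<open>C \<ge> 0\<close>)
  also have "\<dots> = 4 * C * L1_norm f * L1_norm g"
    using norm_eq[OF assms(1) f' ff'] norm_eq[OF assms(2) g' gg'] by simp
  also have "4 * C = sqrt (2 / pi)"
  proof -
    have "4 * C = (sqrt 2 * sqrt 2) / (sqrt 2 * sqrt pi)"
      unfolding C_def real_sqrt_mult by simp
    also have "\<dots> = sqrt (2 / pi)"
      unfolding real_sqrt_divide by (rule mult_divide_mult_cancel_left) simp
    finally show ?thesis .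
  qed
  finally show ?thesis
    using ae int by blast
qed

end
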